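(* Let $\alpha>0$, let $n$ be the positive integer with $n-1<\alpha\le n$, let $b\in\mathbb{R}$ and $b(\alpha)=b-n+1$. For every real-valued function $f$ defined on ${}_{b}\mathbb{N}$, $$({}^{C}_{b}\Delta^\alpha f)(t+\alpha)=({}^{C}_{b(\alpha)}\nabla^\alpha f)(t),\qquad t\in{}_{b-n}\mathbb{N}.$$
   Context: Notation: ${}_{b}\mathbb{N}=\{b,b-1,\dots\}$; $\Delta f(t)=f(t+1)-f(t)$, $\nabla f(t)=f(t)-f(t-1)$, with iterates $\Delta^m,\nabla^m$; $\nabla_{\ominus}^m f(t)=(-1)^m\nabla^m f(t)$, ${}_{\ominus}\Delta^m f(t)=(-1)^m\Delta^m f(t)$; $\sigma(t)=t+1$, $\rho(t)=t-1$. Falling function: $t^{(\beta)}=\Gamma(t+1)/\Gamma(t+1-\beta)$ (division by a pole gives $0$). Rising function: $t^{\overline{\beta}}=\Gamma(t+\beta)/\Gamma(t)$. Delta right Caputo fractional difference: for $n-1<\alpha<n$, $${}^{C}_{b}\Delta^\alpha f(t)=\frac{1}{\Gamma(n-\alpha)}\sum_{s=t+(n-\alpha)}^{b}(s-\sigma(t))^{(n-\alpha-1)}\nabla_{\ominus}^n f(s),\quad t\in{}_{b-(n-\alpha)}\mathbb{N},$$ with $s$ running in unit steps; for $\alpha=n$, ${}^{C}_{b}\Delta^n f(t)=\nabla_{\ominus}^n f(t)$. Dual nabla right Caputo fractional difference: with $b(\alpha)=b-n+1$, for $n-1<\alpha<n$, $${}^{C}_{b(\alpha)}\nabla^\alpha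 f(t)={}_{b(\alpha)}\nabla^{-(n-\alpha)}\,{}_{\ominus}\Delta^n f(t)=\frac{1}{\Gamma(n-\alpha)}\sum_{s=t}^{b(\alpha)-1}(s-\rho(t))^{\overline{n-\alpha-1}}\,{}_{\ominus}\Delta^n f(s),\quad t\in{}_{b-n}\mathbb{N};$$ for $\alpha=n$ it is ${}_{\ominus}\Delta^n f(t)$. *)

theory Defs
  imports "HOL-Analysis.Analysis"
begin

text \<open>
  A function on a set such as \<open>down_set b\<close> is represented by a total function on the reals; no
  value outside the intended domain enters the operators below at the points where the
  literature defines them.
\<close>

definition down_set :: "real \<Rightarrow> real set" where
  "down_set b = {b - real k | k :: nat. True}"

text \<open>The points \<open>c, c + 1, c + 2, \<dots>\<close> not exceeding \<open>d\<close>; \<open>d - c\<close> need not be an integer, and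
  the set is empty (so sums over it vanish) if \<open>d < c\<close>.\<close>

definition unit_steps :: "real \<Rightarrow> real \<Rightarrow> real set" where
  "unit_steps c d = {c + real k | k :: nat. c + real k \<le> d}"

definition fwd_diff :: "(real \<Rightarrow> real) \<Rightarrow> real \<Rightarrow> real" where
  "fwd_diff f t = f (t + 1) - f t"

definition bwd_diff :: "(real \<Rightarrow> real) \<Rightarrow> real \<Rightarrow> real" where
  "bwd_diff f t = f t - f (t - 1)"

definition minus_fwd_diff :: "nat \<Rightarrow> (real \<Rightarrow> real) \<Rightarrow> real \<Rightarrow> real" where
  "minus_fwd_diff m f t = (-1) ^ m * (fwd_diff ^^ m) f t"

definition minus_bwd_diff :: "nat \<Rightarrow> (real \<Rightarrow> real) \<Rightarrow> real \<Rightarrow> real" where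
  "minus_bwd_diff m f t = (-1) ^ m * (bwd_diff ^^ m) f t"

definition fwd_jump :: "real \<Rightarrow> real" where
  "fwd_jump t = t + 1"

definition bwd_jump :: "real \<Rightarrow> real" where
  "bwd_jump t = t - 1"

text \<open>The library's \<open>Gamma\<close> is \<open>0\<close> at its poles and \<open>x / 0 = 0\<close>, so division by a pole gives \<open>0\<close>.\<close>

definition falling_fun :: "real \<Rightarrow> real \<Rightarrow> real" where
  "falling_fun t \<beta> = Gamma (t + 1) / Gamma (t + 1 - \<beta>)"

definition rising_fun :: "real \<Rightarrow> real \<Rightarrow> real" where
  "rising_fun t \<beta> = Gamma (t + \<beta>) / Gamma t"

text \<open>For \<open>\<alpha> > 0\<close>, the positive integer \<open>n\<close> with \<open>n - 1 < \<alpha> \<le> n\<close>.\<close>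

definition frac_order :: "real \<Rightarrow> nat" where
  "frac_order \<alpha> = nat \<lceil>\<alpha>\<rceil>"

definition delta_right_caputo :: "real \<Rightarrow> real \<Rightarrow> (real \<Rightarrow> real) \<Rightarrow> real \<Rightarrow> real" where
  "delta_right_caputo b \<alpha> f t =
    (let n = frac_order \<alpha> in
     if \<alpha> = real n then minus_bwd_diff n f t
     else 1 / Gamma (real n - \<alpha>) *
       (\<Sum>s\<in>unit_steps (t + (real n - \<alpha>)) b.
          falling_fun (s - fwd_jump t) (real n - \<alpha> - 1) * minus_bwd_diff n f s))"

text \<open>The right fractional sum of order \<open>\<beta> > 0\<close>, written with exponent \<open>- \<beta>\<close> in the literature.
  The end point \<open>a\<close> itself is excluded from the summation.\<close>

definition nabla_right_sum :: "real \<Rightarrow> real \<Rightarrow> (real \<Rightarrow> real) \<Rightarrow> real \<Rightarrow> real" where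
  "nabla_right_sum a \<beta> g t =
    1 / Gamma \<beta> * (\<Sum>s\<in>unit_steps t (a - 1). rising_fun (s - bwd_jump t) (\<beta> - 1) * g s)"

text \<open>The first argument \<open>a\<close> is the subscript of the operator, that is \<open>b - n + 1\<close> for a function
  given on \<open>down_set b\<close>.\<close>

definition nabla_right_caputo :: "real \<Rightarrow> real \<Rightarrow> (real \<Rightarrow> real) \<Rightarrow> real \<Rightarrow> real" where
  "nabla_right_caputo a \<alpha> f t =
    (let n = frac_order \<alpha> in
     if \<alpha> = real n then minus_fwd_diff n f t
     else nabla_right_sum a (real n - \<alpha>) (minus_fwd_diff n f) t)"

end

theory Submission
  imports Defs
begin

text \<open>
  One backward difference at \<open>s + 1\<close> is one forward difference at \<open>s\<close>, and both operators commute
  with translations. Hence a backward difference of order \<open>n\<close> at \<open>s + n\<close> is the forward difference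
  of order \<open>n\<close> at \<open>s\<close> (\<open>minus_bwd_diff_shift\<close>). This is already the case \<open>\<alpha> = n\<close>.

  For \<open>\<alpha> < n\<close>, evaluating the delta operator at \<open>t + \<alpha>\<close> makes its summation start at \<open>t + n\<close>, with
  \<open>\<alpha>\<close> cancelled; the substitution \<open>s \<mapsto> s + n\<close> therefore carries the index set of the nabla sum
  onto that of the delta sum (\<open>unit_steps_shift\<close>). The differences match by the first observation,
  and the kernels match because, for the same exponent \<open>\<beta>\<close>, the falling function at \<open>x + \<beta> - 1\<close>
  and the rising function at \<open>x\<close> are the same quotient of Gamma values
  (\<open>falling_fun_eq_rising_fun\<close>).
\<close>

lemma bwd_diff_iterate_shift:
  "(bwd_diff ^^ n) f (s + real n) = (fwd_diff ^^ n) f s"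
proof (induction n arbitrary: s)
  case 0
  then show ?case by simp
next
  case (Suc n)
  have "(bwd_diff ^^ Suc n) f (s + real (Suc n))
      = (bwd_diff ^^ n) f ((s + 1) + real n) - (bwd_diff ^^ n) f (s + real n)"
    by (simp add: bwd_diff_def algebra_simps)
  also have "\<dots> = (fwd_diff ^^ Suc n) f s"
    by (simp add: Suc.IH fwd_diff_def[of "(fwd_diff ^^ n) f"])
  finally show ?case .
qed

lemma minus_bwd_diff_shift:
  "minus_bwd_diff n f (s + real n) = minus_fwd_diff n f s"
  by (simp add: minus_bwd_diff_def minus_fwd_diff_def bwd_diff_iterate_shift)

lemma falling_fun_eq_rising_fun:
  "falling_fun (x + \<beta> - 1) \<beta> = rising_fun x \<beta>"
  by (simp add: falling_fun_def rising_fun_def)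

lemma unit_steps_shift:
  "unit_steps (c + h) (d + h) = (\<lambda>s. s + h) ` unit_steps c d"
  by (auto simp: unit_steps_def image_iff algebra_simps)

lemma frac_order_eq:
  assumes "real n - 1 < \<alpha>" and "\<alpha> \<le> real n"
  shows "frac_order \<alpha> = n"
proof -
  have "\<lceil>\<alpha>\<rceil> = int n"
    using assms by (simp add: ceiling_eq_iff)
  then show ?thesis by (simp add: frac_order_def)
qed

theorem proposition5p2:
  fixes \<alpha> b t :: real and n :: nat and f :: "real \<Rightarrow> real"
  assumes "\<alpha> > 0"
    and "n \<ge> 1" and "real n - 1 < \<alpha>" and "\<alpha> \<le> real n"
    and "t \<in> down_set (b - real n)"
  shows "delta_right_caputo b \<alpha> f (t + \<alpha>) = nabla_right_caputo (b - real n + 1) \<alpha> f t"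
proof -
  have order: "frac_order \<alpha> = n"
    using assms(3,4) by (rule frac_order_eq)
  show ?thesis
  proof (cases "\<alpha> = real n")
    case True
    then show ?thesis
      using order
      by (simp add: delta_right_caputo_def nabla_right_caputo_def minus_bwd_diff_shift)
  next
    case False
    let ?\<beta> = "real n - \<alpha> - 1"
    let ?S = "unit_steps t (b - real n)"
    let ?term = "\<lambda>s. falling_fun (s - fwd_jump (t + \<alpha>)) ?\<beta> * minus_bwd_diff n f s"
    have steps: "unit_steps (t + \<alpha> + (real n - \<alpha>)) b = (\<lambda>s. s + real n) ` ?S"
      using unit_steps_shift[of t "real n" "b - real n"] by simp
    have kernel: "falling_fun (s + real n - fwd_jump (t + \<alpha>)) ?\<beta> = rising_fun (s - bwd_jump t) ?\<beta>"
      for s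
      using falling_fun_eq_rising_fun[of "s - bwd_jump t" ?\<beta>]
      by (simp add: fwd_jump_def bwd_jump_def algebra_simps)
    have "sum ?term (unit_steps (t + \<alpha> + (real n - \<alpha>)) b) = (\<Sum>s\<in>?S. ?term (s + real n))"
      unfolding steps by (simp add: sum.reindex inj_on_def)
    also have "\<dots> = (\<Sum>s\<in>?S. rising_fun (s - bwd_jump t) ?\<beta> * minus_fwd_diff n f s)"
      by (simp only: kernel minus_bwd_diff_shift)
    finally show ?thesis
      using False order
      by (simp add: delta_right_caputo_def nabla_right_caputo_def nabla_right_sum_def)
  qed
qed

end
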